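(* Let $A\in\mathbb{R}^{n\times n}$, $B\in\mathbb{R}^{n\times m}$ with $(A,B)$ controllable and $B$ of full column rank, and let $T>0$. For a given optimal feedback matrix $K(t)$, $t\in[0,T]$, let $$\mathbb{J}(K)=\{(Q,F)\in\mathbb{S}_+^n\times\mathbb{S}_+^n : K=\mathrm{DRE}\{Q,F\}\}.$$ Then in $\mathbb{J}(K)$ the correspondence between $Q$ and $F$ is bijective: for every $Q$ occurring as first component of an element of $\mathbb{J}(K)$ there is exactly one $F\in\mathbb{S}_+^n$ with $(Q,F)\in\mathbb{J}(K)$, and for every $F$ occurring as second component of an element of $\mathbb{J}(K)$ there is exactly one $Q\in\mathbb{S}_+^n$ with $(Q,F)\in\mathbb{J}(K)$.
   Context: $\mathbb{S}_+^n$ is the cone of real symmetric positive semidefinite $n\times n$ matrices. For $Q,F\in\mathbb{S}_+^n$ let $P(t)$ be the solution on $[0,T]$ of the differential Riccati equation $-\dot P=PA+A^TP-PBB^TP+Q$, $P(T)=F$. The finite-horizon LQ problem of minimizing $x^T(T)Fx(T)+\int_0^T(x^TQx+u^Tu)\,dt$ subject to $\dot x=Ax+Bu$, $x(0)=x_0$, has optimal feedback $u=K(t)x$ with $K(t)=-B^TP(t)$ for $t\in[0,T]$; write $K=\mathrm{DRE}\{Q,F\}$ in this case. $Q$ and $F$ are constant matrices. *)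

theory Defs
  imports "HOL-Analysis.Analysis"
begin

(* An n x m matrix is an element of real^'m^'n: the outer index is the row. *)

definition psd_matrices :: "(real^'n^'n) set" where
  "psd_matrices = {Q. transpose Q = Q \<and> (\<forall>x. 0 \<le> x \<bullet> (Q *v x))}"

definition trajectory ::
  "real^'n^'n \<Rightarrow> real^'m^'n \<Rightarrow> real \<Rightarrow> (real \<Rightarrow> real^'m) \<Rightarrow> (real \<Rightarrow> real^'n) \<Rightarrow> bool" where
  "trajectory A B \<tau> u x \<longleftrightarrow>
     (\<forall>t\<in>{0..\<tau>}. (x has_vector_derivative (A *v x t + B *v u t)) (at t within {0..\<tau>}))"

(* Controls are taken continuous, so that trajectories are classical solutions; for
   time-invariant systems larger classes of controls give the same notion. *)
definition controllable :: "real^'n^'n \<Rightarrow> real^'m^'n \<Rightarrow> bool" where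
  "controllable A B \<longleftrightarrow>
     (\<forall>x0 x1. \<exists>\<tau>>0. \<exists>u x. continuous_on {0..\<tau>} u \<and> trajectory A B \<tau> u x \<and> x 0 = x0 \<and> x \<tau> = x1)"

definition riccati_solution ::
  "real^'n^'n \<Rightarrow> real^'m^'n \<Rightarrow> real \<Rightarrow> real^'n^'n \<Rightarrow> real^'n^'n \<Rightarrow> (real \<Rightarrow> real^'n^'n) \<Rightarrow> bool" where
  "riccati_solution A B T Q F P \<longleftrightarrow>
     (\<forall>t\<in>{0..T}. (P has_vector_derivative
        - (P t ** A + transpose A ** P t - P t ** B ** transpose B ** P t + Q)) (at t within {0..T}))
     \<and> P T = F"

(* The identity K = DRE{Q,F}. It is a relation because K and P are functions on [0,T] only,
   so their values at other times must not matter. The solution P is unique on [0,T]. *)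
definition is_DRE ::
  "real^'n^'n \<Rightarrow> real^'m^'n \<Rightarrow> real \<Rightarrow> (real \<Rightarrow> real^'n^'m) \<Rightarrow> real^'n^'n \<Rightarrow> real^'n^'n \<Rightarrow> bool" where
  "is_DRE A B T K Q F \<longleftrightarrow>
     (\<exists>P. riccati_solution A B T Q F P \<and> (\<forall>t\<in>{0..T}. K t = - (transpose B ** P t)))"

definition weight_pairs ::
  "real^'n^'n \<Rightarrow> real^'m^'n \<Rightarrow> real \<Rightarrow> (real \<Rightarrow> real^'n^'m) \<Rightarrow> ((real^'n^'n) \<times> (real^'n^'n)) set" where
  "weight_pairs A B T K = {(Q, F). Q \<in> psd_matrices \<and> F \<in> psd_matrices \<and> is_DRE A B T K Q F}"

end

theory Submission
  imports Defs
begin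

text \<open>Two pairs with the same feedback have Riccati solutions that are symmetric, hence have the same
quadratic term \<open>K\<^sup>T K\<close>; so their difference \<open>D\<close> solves the linear equation
\<open>-D' = D A + A\<^sup>T D + E\<close>, where \<open>E\<close> is the difference of the state weights, and \<open>D B = 0\<close> on \<open>[0,T]\<close>.
Differentiating \<open>D A\<^sup>k B = 0\<close> gives \<open>D A\<^sup>k\<^sup>+\<^sup>1 B + E A\<^sup>k B = 0\<close>. If \<open>E = 0\<close>, or if \<open>D T = 0\<close> (evaluate at
\<open>t = T\<close>), then both terms vanish, and by induction all \<open>D A\<^sup>k B\<close> and \<open>E A\<^sup>k B\<close> are zero. By
controllability \<open>D\<close> and \<open>E\<close> are zero.\<close>

text \<open>A Gronwall argument: the square of the norm of \<open>z\<close> grows or decays at rate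
  at most \<open>2 * C\<close>, so an exponential weight makes it monotone. It runs forward and
  backward from \<open>s\<close>; later the zero is at the initial time for a trajectory and at the
  final time for a Riccati solution.\<close>

lemma vanishing_by_linear_growth:
  fixes z :: "real \<Rightarrow> 'a::real_inner"
  assumes der: "\<And>t. t \<in> {a..b} \<Longrightarrow> (z has_vector_derivative z' t) (at t within {a..b})"
    and bound: "\<And>t. t \<in> {a..b} \<Longrightarrow> norm (z' t) \<le> C * norm (z t)"
    and s: "s \<in> {a..b}" "z s = 0" and t: "t \<in> {a..b}"
  shows "z t = 0"
proof -
  have le: "\<bar>z r \<bullet> z' r\<bar> \<le> C * (z r \<bullet> z r)" if "r \<in> {a..b}" for r
  proof -
    have "\<bar>z r \<bullet> z' r\<bar> \<le> norm (z r) * norm (z' r)"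
      by (rule Cauchy_Schwarz_ineq2)
    also have "\<dots> \<le> norm (z r) * (C * norm (z r))"
      by (intro mult_left_mono bound that) auto
    finally show ?thesis
      by (simp add: dot_square_norm power2_eq_square mult_ac)
  qed
  \<comment> \<open>The rate \<open>c\<close> stays free: it becomes \<open>- 2 * C\<close> to the
    right of \<open>s\<close> and \<open>2 * C\<close> to the left.\<close>
  have der_weighted: "((\<lambda>r. (z r \<bullet> z r) * exp (c * r)) has_real_derivative
        (2 * (z r \<bullet> z' r) + c * (z r \<bullet> z r)) * exp (c * r)) (at r within {a..b})"
    if "r \<in> {a..b}" for r c
  proof -
    have "((\<lambda>r. z r \<bullet> z r) has_real_derivative 2 * (z r \<bullet> z' r)) (at r within {a..b})"
      using bounded_bilinear.has_vector_derivative[OF bounded_bilinear_inner der[OF that] der[OF that]]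
      by (simp add: has_real_derivative_iff_has_vector_derivative inner_commute)
    then show ?thesis
      by (auto intro!: derivative_eq_intros simp: algebra_simps)
  qed
  have mvt: "\<exists>r\<in>{p..q}. (z q \<bullet> z q) * exp (c * q) - (z p \<bullet> z p) * exp (c * p)
      = (2 * (z r \<bullet> z' r) + c * (z r \<bullet> z r)) * exp (c * r) * (q - p)"
    if "a \<le> p" "p \<le> q" "q \<le> b" for p q c
    using that
    by (intro mvt_very_simple[where f' = "\<lambda>r. (*) ((2 * (z r \<bullet> z' r) + c * (z r \<bullet> z r)) * exp (c * r))"])
      (auto intro!: DERIV_subset[OF der_weighted] simp flip: has_field_derivative_def)
  have "z t \<bullet> z t \<le> 0"
  proof (cases "s \<le> t")
    case True
    then obtain r where r: "r \<in> {s..t}" and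
      eq: "(z t \<bullet> z t) * exp (- 2 * C * t) - (z s \<bullet> z s) * exp (- 2 * C * s)
        = (2 * (z r \<bullet> z' r) + - 2 * C * (z r \<bullet> z r)) * exp (- 2 * C * r) * (t - s)"
      using mvt[of s t "- 2 * C"] s t by auto
    have "(2 * (z r \<bullet> z' r) + - 2 * C * (z r \<bullet> z r)) * exp (- 2 * C * r) * (t - s) \<le> 0"
      using le[of r] r s t True by (intro mult_nonpos_nonneg) auto
    then have "(z t \<bullet> z t) * exp (- 2 * C * t) \<le> 0"
      using eq s by simp
    then show ?thesis
      by (simp add: mult_le_0_iff)
  next
    case False
    then obtain r where r: "r \<in> {t..s}" and
      eq: "(z s \<bullet> z s) * exp (2 * C * s) - (z t \<bullet> z t) * exp (2 * C * t)
        = (2 * (z r \<bullet> z' r) + 2 * C * (z r \<bullet> z r)) * exp (2 * C * r) * (s - t)"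
      using mvt[of t s "2 * C"] s t by auto
    have "0 \<le> (2 * (z r \<bullet> z' r) + 2 * C * (z r \<bullet> z r)) * exp (2 * C * r) * (s - t)"
      using le[of r] r s t False by (intro mult_nonneg_nonneg) auto
    then have "(z t \<bullet> z t) * exp (2 * C * t) \<le> 0"
      using eq s by simp
    then show ?thesis
      by (simp add: mult_le_0_iff)
  qed
  then show ?thesis
    using inner_ge_zero[of "z t"] by simp
qed

lemma bounded_bilinear_matrix_matrix_mult:
  "bounded_bilinear ((**) :: real^'n^'m \<Rightarrow> real^'p^'n \<Rightarrow> real^'p^'m)"
  unfolding bilinear_conv_bounded_bilinear[symmetric] bilinear_def
  by (auto intro!: linearI simp: matrix_matrix_mult_def vec_eq_iff distrib_left distrib_right
      sum.distrib sum_distrib_left mult_ac)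

interpretation matrix_mult: bounded_bilinear "(**) :: real^'n^'m \<Rightarrow> real^'p^'n \<Rightarrow> real^'p^'m"
  by (rule bounded_bilinear_matrix_matrix_mult)

lemma bounded_linear_transpose: "bounded_linear (transpose :: real^'n^'m \<Rightarrow> real^'m^'n)"
  unfolding linear_conv_bounded_linear[symmetric]
  by (auto intro!: linearI simp: transpose_def vec_eq_iff)

lemmas transpose_linear_simps =
  linear_add[OF bounded_linear.linear[OF bounded_linear_transpose]]
  linear_diff[OF bounded_linear.linear[OF bounded_linear_transpose]]
  linear_neg[OF bounded_linear.linear[OF bounded_linear_transpose]]

text \<open>Half of Kalman's criterion, drawn from the definition by trajectories. The annihilators
  of all \<open>A^k B\<close> form a space invariant under the transpose of \<open>A\<close> and
  orthogonal to the range of \<open>B\<close>. Projected onto it, a trajectory from the origin obeys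
  a homogeneous linear equation and stays zero, yet controllability steers it to
  \<open>y\<close>.\<close>

lemma controllable_annihilator_zero:
  fixes A :: "real^'n^'n" and B :: "real^'m^'n"
  assumes "controllable A B"
    and y: "\<And>k w. y \<bullet> ((((**) A ^^ k) B) *v w) = 0"
  shows "y = 0"
proof -
  define U where "U = {y. \<forall>k w. y \<bullet> ((((**) A ^^ k) B) *v w) = 0}"
  have inv: "transpose A *v b \<in> U" if "b \<in> U" for b
  proof -
    have "b \<bullet> (((**) A ^^ Suc k) B *v w) = 0" for k w
      using that unfolding U_def by blast
    then show ?thesis
      unfolding U_def by (simp add: transpose_matrix_vector dot_lmul_matrix flip: matrix_vector_mul_assoc)
  qed
  have UB: "b \<bullet> (B *v w) = 0" if "b \<in> U" for b w
    using that unfolding U_def by (metis (mono_tags, lifting) funpow_0 mem_Collect_eq)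
  have "subspace U"
    by (auto simp: U_def subspace_def inner_left_distrib)
  then obtain S where S: "S \<subseteq> U" "pairwise orthogonal S" "\<And>b. b \<in> S \<Longrightarrow> norm b = 1"
      "independent S" "card S = dim U" "span S = U"
    by (rule orthonormal_basis_subspace) blast
  have "finite S"
    using S by (simp add: independent_imp_finite)
  \<comment> \<open>The orthogonal projection onto \<open>U\<close>, in an orthonormal
    basis.\<close>
  define p where "p v = (\<Sum>b\<in>S. (b \<bullet> v) *\<^sub>R b)" for v
  have p: "bounded_linear p"
    unfolding p_def by (intro bounded_linear_intros)
  have "b \<bullet> p v = b \<bullet> v" if "b \<in> S" for b v
  proof -
    have "b \<bullet> p v = (\<Sum>c\<in>S. (c \<bullet> v) * (b \<bullet> c))"
      unfolding p_def by (simp add: inner_sum_right)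
    also have "\<dots> = (\<Sum>c\<in>S. if c = b then b \<bullet> v else 0)"
      using S(2,3) that by (intro sum.cong) (auto simp: pairwise_def orthogonal_def norm_eq_1)
    finally show ?thesis
      using that \<open>finite S\<close> by simp
  qed
  then have "b \<in> S \<Longrightarrow> b \<in> {u. \<forall>v. u \<bullet> p v = u \<bullet> v}" for b
    by blast
  moreover have "subspace {u. \<forall>v. u \<bullet> p v = u \<bullet> v}"
    by (auto simp: subspace_def inner_left_distrib)
  ultimately have dot_p: "u \<bullet> p v = u \<bullet> v" if "u \<in> U" for u v
    using that span_minimal[of S "{u. \<forall>v. u \<bullet> p v = u \<bullet> v}"] S(6) by blast
  \<comment> \<open>The control drops out by \<open>UB\<close>. Invariance moves \<open>A\<close> to
    the other side of the inner product, where \<open>v\<close> and \<open>p v\<close> cannot be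
    told apart by vectors of \<open>U\<close>.\<close>
  have p_dyn: "p (A *v v + B *v w) = p (A *v p v)" for v w
    unfolding p_def
  proof (rule sum.cong)
    fix b assume "b \<in> S"
    then have "b \<in> U" using S by blast
    then have "b \<bullet> (A *v v) = b \<bullet> (A *v p v)"
      using dot_p[OF inv[OF \<open>b \<in> U\<close>]] by (simp add: transpose_matrix_vector dot_lmul_matrix)
    then show "(b \<bullet> (A *v v + B *v w)) *\<^sub>R b = (b \<bullet> (A *v (\<Sum>b\<in>S. (b \<bullet> v) *\<^sub>R b))) *\<^sub>R b"
      using UB[OF \<open>b \<in> U\<close>] by (simp add: inner_right_distrib p_def)
  qed simp
  obtain \<tau> u x where "\<tau> > 0" and traj: "trajectory A B \<tau> u x" and "x 0 = 0" "x \<tau> = y"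
    using \<open>controllable A B\<close> unfolding controllable_def by blast
  have "bounded_linear (\<lambda>v. p (A *v v))"
    using bounded_linear_compose[OF p matrix_vector_mul_bounded_linear] .
  then obtain C where C: "\<And>v. norm (p (A *v v)) \<le> norm v * C"
    using bounded_linear.bounded by blast
  have "p (x \<tau>) = 0"
  proof (rule vanishing_by_linear_growth[where z = "\<lambda>t. p (x t)" and s = 0])
    show "((\<lambda>t. p (x t)) has_vector_derivative p (A *v p (x t))) (at t within {0..\<tau>})"
      if "t \<in> {0..\<tau>}" for t
      using bounded_linear.has_vector_derivative[OF p] traj that p_dyn
      unfolding trajectory_def by metis
  qed (use C \<open>\<tau> > 0\<close> \<open>x 0 = 0\<close> in \<open>auto simp: mult.commute p_def\<close>)
  moreover have "y \<in> U"
    using y unfolding U_def by blast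
  ultimately have "y \<bullet> y = 0"
    using dot_p[of y y] \<open>x \<tau> = y\<close> by simp
  then show ?thesis by simp
qed

text \<open>Each row of \<open>D\<close> is an annihilator in the sense of the preceding
  lemma.\<close>

lemma controllable_matrix_zero:
  fixes A :: "real^'n^'n" and B :: "real^'m^'n" and D :: "real^'n^'k"
  assumes "controllable A B" and D: "\<And>k. D ** ((**) A ^^ k) B = 0"
  shows "D = 0"
proof -
  have "D $ i \<bullet> (((**) A ^^ k) B *v w) = 0" for i k w
    using arg_cong[OF D[of k], of "\<lambda>X. (X *v w) $ i"]
    by (simp flip: matrix_vector_mul_assoc add: matrix_vector_mul_component)
  then show ?thesis
    using controllable_annihilator_zero[OF assms(1)] by (simp add: vec_eq_iff)
qed

text \<open>Matrices \<open>X\<close> with \<open>D t ** X = 0\<close> on the whole interval are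
  carried to \<open>A ** X\<close>, starting from \<open>B\<close>. The left coefficient
  \<open>N\<close> can be arbitrary because \<open>N ** D t ** X\<close> vanishes along with
  \<open>D t ** X\<close>.\<close>

lemma linear_matrix_ode_kernel_zero:
  fixes A :: "real^'n^'n" and B :: "real^'m^'n" and D :: "real \<Rightarrow> real^'n^'k"
  assumes ctrl: "controllable A B" and "T > 0"
    and der: "\<And>t. t \<in> {0..T} \<Longrightarrow>
      (D has_vector_derivative - (D t ** A + N ** D t + E)) (at t within {0..T})"
    and DB: "\<And>t. t \<in> {0..T} \<Longrightarrow> D t ** B = 0"
    and zero: "E = 0 \<or> D T = 0"
  shows "E = 0" and "\<And>t. t \<in> {0..T} \<Longrightarrow> D t = 0"
proof -
  \<comment> \<open>The derivative of \<open>D t ** X\<close> is computed twice, by linearity and as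
    that of the zero function; derivatives within the interval are unique, also at its ends, as
    \<open>T > 0\<close>.\<close>
  have step: "D t ** (A ** X) + E ** X = 0"
    if X: "\<And>t. t \<in> {0..T} \<Longrightarrow> D t ** X = 0" and t: "t \<in> {0..T}" for t and X :: "real^'m^'n"
  proof -
    have "((\<lambda>t. D t ** X) has_vector_derivative - (D t ** A + N ** D t + E) ** X) (at t within {0..T})"
      by (rule bounded_linear.has_vector_derivative[OF matrix_mult.bounded_linear_left der[OF t]])
    moreover have "((\<lambda>t. D t ** X) has_vector_derivative 0) (at t within {0..T})"
      by (rule has_vector_derivative_transform[OF t, of _ "\<lambda>_. 0"]) (use X in auto)
    ultimately have "- (D t ** A + N ** D t + E) ** X = 0"
      using vector_derivative_unique_within_closed_interval[of 0 T t] \<open>T > 0\<close> t by (metis box_real(2))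
    moreover have "- (D t ** A + N ** D t + E) ** X = - (D t ** (A ** X) + E ** X)"
      using X[OF t]
      by (simp only: matrix_mult.minus_left matrix_mult.add_left matrix_mult.zero_right add_0_right
          flip: matrix_mul_assoc)
    ultimately show ?thesis
      by (metis neg_equal_0_iff_equal)
  qed
  \<comment> \<open>If \<open>D T = 0\<close>, then \<open>step\<close> at the final time gives
    \<open>E ** X = 0\<close>; as \<open>E\<close> is constant, this removes it from
    \<open>step\<close> at every other time.\<close>
  have split: "D t ** (A ** X) = 0" "E ** X = 0"
    if "\<And>t. t \<in> {0..T} \<Longrightarrow> D t ** X = 0" and "t \<in> {0..T}" for t and X :: "real^'m^'n"
    using step[OF that] step[OF that(1), of T] zero \<open>T > 0\<close> by auto
  have DA: "D t ** ((**) A ^^ k) B = 0" if "t \<in> {0..T}" for t k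
    using that
  \<comment> \<open>The time is generalized because \<open>split\<close> needs its hypothesis on all
    of the interval.\<close>
  proof (induction k arbitrary: t)
    case (Suc k)
    then show ?case using split(1) by simp
  qed (simp add: DB)
  have "E ** ((**) A ^^ k) B = 0" for k
    using split(2)[OF DA, of T] \<open>T > 0\<close> by auto
  then show "E = 0"
    by (rule controllable_matrix_zero[OF ctrl])
  show "\<And>t. t \<in> {0..T} \<Longrightarrow> D t = 0"
    using controllable_matrix_zero[OF ctrl DA] .
qed

text \<open>The skew part of \<open>P\<close> solves a homogeneous linear equation with continuous
  coefficients and is zero at the final time. Symmetry will turn equality of feedbacks into equality
  of the products \<open>P t ** B\<close>.\<close>

lemma riccati_solution_symmetric:
  fixes A :: "real^'n^'n" and B :: "real^'m^'n"
  assumes sol: "riccati_solution A B T Q F P"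
    and Q: "transpose Q = Q" and F: "transpose F = F" and t: "t \<in> {0..T}"
  shows "transpose (P t) = P t"
proof -
  define G where "G = B ** transpose B"
  define S where "S t = P t - transpose (P t)" for t
  \<comment> \<open>With \<open>P\<close> on the right in \<open>M\<close> and its transpose on the
    left in \<open>N\<close>, the mixed terms of \<open>S t ** M t + N t ** S t\<close> cancel,
    leaving the difference of the two quadratic terms.\<close>
  define M where "M t = A - G ** P t" for t
  define N where "N t = transpose A - transpose (P t) ** G" for t
  have der: "(P has_vector_derivative - (P t ** A + transpose A ** P t - P t ** G ** P t + Q))
      (at t within {0..T})" if "t \<in> {0..T}" for t
    using sol that unfolding riccati_solution_def G_def by (auto simp: matrix_mul_assoc)
  have derS: "(S has_vector_derivative - (S t ** M t + N t ** S t)) (at t within {0..T})"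
    if "t \<in> {0..T}" for t
  proof -
    have "transpose G = G"
      by (simp add: G_def matrix_transpose_mul)
    then have eq: "- (S t ** M t + N t ** S t) =
        - (P t ** A + transpose A ** P t - P t ** G ** P t + Q)
        - transpose (- (P t ** A + transpose A ** P t - P t ** G ** P t + Q))"
      by (simp add: S_def M_def N_def Q transpose_linear_simps matrix_transpose_mul
          matrix_mult.diff_left matrix_mult.diff_right matrix_mul_assoc)
    show ?thesis
      unfolding eq unfolding S_def[abs_def]
      by (intro has_vector_derivative_diff der that
          bounded_linear.has_vector_derivative[OF bounded_linear_transpose])
  qed
  have cont: "continuous_on {0..T} P"
    using der has_vector_derivative_continuous continuous_on_eq_continuous_within by blast
  have "continuous_on {0..T} M" "continuous_on {0..T} N"
    unfolding M_def N_def
    by (intro continuous_intros cont matrix_mult.continuous_on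
        bounded_linear.continuous_on[OF bounded_linear_transpose])+
  \<comment> \<open>Compactness gives uniform bounds on the coefficients, hence a single growth
    constant for \<open>S\<close>.\<close>
  then have "bounded (M ` {0..T})" "bounded (N ` {0..T})"
    by (auto intro!: compact_imp_bounded compact_continuous_image)
  then obtain m n where m: "\<And>t. t \<in> {0..T} \<Longrightarrow> norm (M t) \<le> m"
      and n: "\<And>t. t \<in> {0..T} \<Longrightarrow> norm (N t) \<le> n"
    unfolding bounded_iff by blast
  obtain c where c: "c \<ge> 0" "\<And>(X :: real^'n^'n) (Y :: real^'n^'n). norm (X ** Y) \<le> norm X * norm Y * c"
    using matrix_mult.nonneg_bounded by blast
  have "S t = 0"
  proof (rule vanishing_by_linear_growth[where z = S and s = T, OF derS])
    fix t assume t: "t \<in> {0..T}"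
    have "norm (- (S t ** M t + N t ** S t)) \<le> norm (S t ** M t) + norm (N t ** S t)"
      unfolding norm_minus_cancel by (rule norm_triangle_ineq)
    also have "\<dots> \<le> norm (S t) * norm (M t) * c + norm (N t) * norm (S t) * c"
      by (intro add_mono c)
    also have "\<dots> \<le> norm (S t) * m * c + n * norm (S t) * c"
      using m[OF t] n[OF t] c(1)
      by (intro add_mono mult_right_mono mult_left_mono) auto
    finally show "norm (- (S t ** M t + N t ** S t)) \<le> (m * c + n * c) * norm (S t)"
      by (simp add: algebra_simps)
  next
    show "S T = 0"
      using sol F by (simp add: S_def riccati_solution_def)
  qed (use t in auto)
  then show ?thesis
    by (simp add: S_def)
qed

text \<open>The disjunction covers both directions of the bijection: equal state weights make the
  source term \<open>Q1 - Q2\<close> vanish, equal terminal weights make \<open>D T\<close>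
  vanish.\<close>

lemma weight_pairs_eq:
  assumes ctrl: "controllable A B" and "T > 0"
    and "(Q1, F1) \<in> weight_pairs A B T K" "(Q2, F2) \<in> weight_pairs A B T K"
    and eq: "Q1 = Q2 \<or> F1 = F2"
  shows "Q1 = Q2 \<and> F1 = F2"
proof -
  obtain P1 P2 where sol: "riccati_solution A B T Q1 F1 P1" "riccati_solution A B T Q2 F2 P2"
      and K: "\<And>t. t \<in> {0..T} \<Longrightarrow> K t = - (transpose B ** P1 t)"
        "\<And>t. t \<in> {0..T} \<Longrightarrow> K t = - (transpose B ** P2 t)"
      and sym: "transpose Q1 = Q1" "transpose F1 = F1" "transpose Q2 = Q2" "transpose F2 = F2"
    using assms(3,4) unfolding weight_pairs_def is_DRE_def psd_matrices_def by blast
  note symP = riccati_solution_symmetric[OF sol(1) sym(1,2)] riccati_solution_symmetric[OF sol(2) sym(3,4)]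
  have BP: "transpose B ** P1 t = transpose B ** P2 t" if "t \<in> {0..T}" for t
    using K[OF that] by simp
  have PB: "P1 t ** B = P2 t ** B" if "t \<in> {0..T}" for t
    using arg_cong[OF BP[OF that], of transpose] symP[OF that] by (simp add: matrix_transpose_mul)
  define D where "D t = P1 t - P2 t" for t
  have der: "(D has_vector_derivative - (D t ** A + transpose A ** D t + (Q1 - Q2))) (at t within {0..T})"
    if t: "t \<in> {0..T}" for t
  proof -
    \<comment> \<open>Both outer factors agree, so the quadratic terms cancel and the equation for
      \<open>D\<close> is linear.\<close>
    have "P1 t ** B ** transpose B ** P1 t = P2 t ** B ** transpose B ** P2 t"
      using BP[OF t] PB[OF t] by (simp flip: matrix_mul_assoc)
    then have eq: "- (D t ** A + transpose A ** D t + (Q1 - Q2)) =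
        - (P1 t ** A + transpose A ** P1 t - P1 t ** B ** transpose B ** P1 t + Q1)
        - - (P2 t ** A + transpose A ** P2 t - P2 t ** B ** transpose B ** P2 t + Q2)"
      by (simp add: D_def matrix_mult.diff_left matrix_mult.diff_right)
    show ?thesis
      unfolding eq unfolding D_def[abs_def]
      using sol t by (intro has_vector_derivative_diff) (auto simp: riccati_solution_def)
  qed
  have DB: "D t ** B = 0" if "t \<in> {0..T}" for t
    using PB[OF that] by (simp add: D_def matrix_mult.diff_left)
  have DT: "D T = F1 - F2"
    using sol by (simp add: D_def riccati_solution_def)
  have "Q1 - Q2 = 0 \<or> D T = 0"
    using eq DT by auto
  from linear_matrix_ode_kernel_zero[OF ctrl \<open>T > 0\<close> der DB this] DT \<open>T > 0\<close>
  show ?thesis by simp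
qed

theorem proposition12:
  fixes A :: "real^'n^'n" and B :: "real^'m^'n" and T :: real
    and K :: "real \<Rightarrow> real^'n^'m"
  assumes "controllable A B"
    and "rank B = CARD('m)"
    and "T > 0"
    and "\<exists>Q0\<in>psd_matrices. \<exists>F0\<in>psd_matrices. is_DRE A B T K Q0 F0"
  shows "(\<forall>Q \<in> fst ` weight_pairs A B T K.
            \<exists>!F. F \<in> psd_matrices \<and> (Q, F) \<in> weight_pairs A B T K) \<and>
         (\<forall>F \<in> snd ` weight_pairs A B T K.
            \<exists>!Q. Q \<in> psd_matrices \<and> (Q, F) \<in> weight_pairs A B T K)"
proof (intro conjI ballI)
  fix Q assume "Q \<in> fst ` weight_pairs A B T K"
  then obtain F where F: "(Q, F) \<in> weight_pairs A B T K" by force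
  then have "F \<in> psd_matrices" by (simp add: weight_pairs_def)
  with F show "\<exists>!F. F \<in> psd_matrices \<and> (Q, F) \<in> weight_pairs A B T K"
    using weight_pairs_eq[OF assms(1,3) F] by blast
next
  fix F assume "F \<in> snd ` weight_pairs A B T K"
  then obtain Q where Q: "(Q, F) \<in> weight_pairs A B T K" by force
  then have "Q \<in> psd_matrices" by (simp add: weight_pairs_def)
  with Q show "\<exists>!Q. Q \<in> psd_matrices \<and> (Q, F) \<in> weight_pairs A B T K"
    using weight_pairs_eq[OF assms(1,3) Q] by blast
qed

end
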